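(* $$\frac{\pi}{4} = \sum_{n=1}^{\infty} \sum_{k=0}^{n} \frac{(-1)^{k+n}\, \operatorname{Si}(\pi(n+1-k)) \binom{2n+1}{k} (n-k+1)}{n^2 \binom{2n}{n} (2n-k+2)}.$$
   Context: $\operatorname{Si}$ denotes the sine integral, $\operatorname{Si}(z) = \int_0^z \frac{\sin t}{t}\,dt$. The double series is an iterated sum: for each $n$ the inner sum over $k$ is finite, and the outer sum is an infinite series over $n$. *)

theory Defs
  imports "HOL-Probability.Sinc_Integral"
begin

text \<open>
  The sine integral is the library's \<^const>\<open>Si\<close> on the reals,
  \<open>Si t = LBINT x=0..t. sin x / x\<close>.  In the summand all differences are taken in the reals,
  so no subtraction is truncated.
\<close>

definition si_summand :: "nat \<Rightarrow> nat \<Rightarrow> real" where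
  "si_summand n k =
     ((-1) ^ (k + n) * Si (pi * (real n + 1 - real k)) * real ((2 * n + 1) choose k)
        * (real n - real k + 1))
     / ((real n)\<^sup>2 * real ((2 * n) choose n) * (2 * real n - real k + 2))"

end

theory Submission
  imports Defs "HOL-Real_Asymp.Real_Asymp"
begin

text \<open>
  Write \<open>N = n + 1\<close> and \<open>j = N - k\<close>.  Absorbing the factor \<open>1 / (N + j)\<close> into the binomial
  coefficient turns the inner sum into a multiple of
  \<open>\<Sum>j. (-1)^(j+1) j (2N choose N-j) Si (\<pi> j)\<close>.  Replace \<open>\<pi>\<close> by a variable \<open>t\<close> and
  differentiate: \<open>Si\<close> becomes \<open>sin (j t) / t\<close>, and the sum of the sines is, up to a factor, the
  derivative of the binomial expansion of \<open>(2 sin (t/2))^(2N)\<close>.  The derivative of the \<open>n\<close>-th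
  inner sum is therefore
  \<open>1/2 * (sin t / t) * (2 sin (t/2))^(2n) / (n\<^sup>2 (2n choose n))\<close> (\<open>DERIV_si_sum\<close>).

  The last factor is the \<open>n\<close>-th term of the classical series
  \<open>2 arcsin\<^sup>2 x = \<Sum>n\<ge>1. (2x)^(2n) / (n\<^sup>2 (2n choose n))\<close> at \<open>x = sin (t/2)\<close>, whose sum is
  \<open>t\<^sup>2/2\<close> on \<open>[0, \<pi>]\<close>.  Thus the derivatives add up to \<open>t sin t / 4\<close>, which has the primitive
  \<open>(sin t - t cos t) / 4\<close>, vanishing at \<open>0\<close> and equal to \<open>\<pi>/4\<close> at \<open>\<pi>\<close>.

  What must be justified is the passage to the limit, up to the endpoint \<open>t = \<pi>\<close> where the
  arcsine series is at its radius of convergence.  Let \<open>r\<close> be \<open>t\<^sup>2/2\<close> minus the sum of the first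
  \<open>m\<close> terms.  Two differentiations make the series telescope to
  \<open>r'' = (2 sin (t/2))^(2m) / (2m choose m)\<close> (\<open>DERIV_arcsin_sq_rest'\<close>), and since
  \<open>r 0 = r' 0 = 0\<close> this gives \<open>0 \<le> r\<close>.  An upper bound that tends to \<open>0\<close> uniformly in \<open>t\<close>
  (\<open>arcsin_sq_rest_le\<close>) comes from \<open>r + (\<pi> - t) r'\<close>: its derivative is
  \<open>(\<pi> - t) r'' \<le> 4 cos (t/2) r''\<close>, which has an elementary primitive whose size a Wallis-type
  estimate controls (\<open>wallis_bound\<close>).  All comparisons are between functions
  through the signs of their derivatives, so no integral has to be computed or interchanged with a
  sum.
\<close>

section \<open>Central binomial coefficients\<close>

lemma central_binomial_Suc:
  "(m + 1) * ((2 * m + 2) choose (m + 1)) = 2 * (2 * m + 1) * ((2 * m) choose m)"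
proof -
  have 1: "(m + 1) * ((2 * m + 2) choose (m + 1)) = (2 * m + 2) * ((2 * m + 1) choose m)"
    using Suc_times_binomial[of m "2 * m + 1"] by simp
  have 2: "(m + 1) * ((2 * m + 1) choose m) = (2 * m + 1) * ((2 * m) choose m)"
    using binomial_absorb_comp[of "2 * m + 1" m] by simp
  have "(m + 1) * ((2 * m + 2) choose (m + 1)) = 2 * ((m + 1) * ((2 * m + 1) choose m))"
    using 1 by (simp add: algebra_simps)
  also have "\<dots> = 2 * (2 * m + 1) * ((2 * m) choose m)"
    by (simp only: 2 mult.assoc)
  finally show ?thesis .
qed

lemma central_binomial_Suc_real:
  "real ((2 * Suc m) choose Suc m) = 2 * (2 * real m + 1) * real ((2 * m) choose m) / (real m + 1)"
proof -
  have "(real m + 1) * real ((2 * m + 2) choose (m + 1)) = 2 * (2 * real m + 1) * real ((2 * m) choose m)"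
    using arg_cong[OF central_binomial_Suc[of m], of real] by (simp add: algebra_simps)
  thus ?thesis by (simp add: field_simps)
qed

text \<open>
  The left-hand side is half the integral of \<open>sin^(2m+1)\<close> over \<open>[0, \<pi>]\<close>, hence of order
  \<open>1 / sqrt m\<close>; the weaker elementary bound \<open>4^m / (2m) \<le> (2m choose m)\<close> would not even show that
  it tends to \<open>0\<close>.  The square of the bound is chosen so that it survives multiplication by the
  squared ratio of consecutive terms, which comes down to
  \<open>4 (m + 1) (m + 2) \<le> (2m + 3)\<^sup>2\<close>.
\<close>

lemma wallis_bound:
  "4 ^ m / ((2 * real m + 1) * real ((2 * m) choose m)) \<le> 1 / sqrt (real m + 1)"
proof -
  define x where "x m = 4 ^ m / ((2 * real m + 1) * real ((2 * m) choose m))" for m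
  have pos: "x m \<ge> 0" for m by (simp add: x_def)
  have step: "x (Suc m) = x m * ((2 * real m + 2) / (2 * real m + 3))" for m
  proof -
    have "real ((2 * m) choose m) \<noteq> 0" by simp
    thus ?thesis
      unfolding x_def central_binomial_Suc_real
      by (simp add: divide_simps) (simp add: algebra_simps)
  qed
  have "(x m)\<^sup>2 \<le> 1 / (real m + 1)"
  proof (induction m)
    case 0
    show ?case by (simp add: x_def)
  next
    case (Suc m)
    have "(x (Suc m))\<^sup>2 = (x m)\<^sup>2 * ((2 * real m + 2) / (2 * real m + 3))\<^sup>2"
      unfolding step by (rule power_mult_distrib)
    also have "\<dots> \<le> 1 / (real m + 1) * ((2 * real m + 2) / (2 * real m + 3))\<^sup>2"
      by (intro mult_right_mono Suc.IH) simp
    also have "\<dots> = 4 * (real m + 1) / (2 * real m + 3)\<^sup>2"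
    proof -
      have "(2 * real m + 2)\<^sup>2 = 4 * (real m + 1) * (real m + 1)"
        by (simp add: power2_eq_square algebra_simps)
      thus ?thesis by (simp add: power_divide)
    qed
    also have "\<dots> \<le> 1 / (real (Suc m) + 1)"
      by (simp add: divide_simps power2_eq_square) (simp add: algebra_simps)
    finally show ?case .
  qed
  hence "x m \<le> sqrt (1 / (real m + 1))" by (rule real_le_rsqrt)
  thus ?thesis by (simp add: x_def real_sqrt_divide)
qed

section \<open>The inner sum as a trigonometric polynomial\<close>

definition chord :: "real \<Rightarrow> real" where
  "chord t = 2 * sin (t / 2)"

lemma DERIV_chord: "(chord has_real_derivative cos (t / 2)) (at t)"
  unfolding chord_def [abs_def] by (auto intro!: derivative_eq_intros)

lemma DERIV_chord_power:
  "((\<lambda>t. chord t ^ Suc k) has_real_derivative real (Suc k) * chord t ^ k * cos (t / 2)) (at t)"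
  using DERIV_power_Suc[OF DERIV_chord, of k t] by (simp add: mult_ac)

text \<open>
  With \<open>z = cis t\<close> one has \<open>(1 - z)\<^sup>2 = - (chord t)\<^sup>2 z\<close>, so \<open>(1 - z)^(2N)\<close> is a real multiple of
  \<open>z^N\<close>; the expansion is the real part of the binomial theorem divided by \<open>z^N\<close>.
\<close>

lemma chord_power_eq_cos_sum:
  "chord t ^ (2 * N) =
     (\<Sum>k\<le>2 * N. (-1) ^ (k + N) * real ((2 * N) choose k) * cos ((real k - real N) * t))"
proof -
  define z where "z = cis t"
  have "1 - z = - 2 * \<i> * of_real (sin (t / 2)) * cis (t / 2)"
  proof -
    have "cos t = 1 - 2 * (sin (t / 2))\<^sup>2" "sin t = 2 * sin (t / 2) * cos (t / 2)"
      using cos_double_sin[of "t / 2"] sin_double[of "t / 2"] by simp_all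
    thus ?thesis
      by (simp add: z_def complex_eq_iff power2_eq_square)
  qed
  hence "(1 - z)\<^sup>2 = - of_real ((chord t)\<^sup>2) * z"
    by (simp add: power_mult_distrib chord_def z_def Complex.DeMoivre)
  hence "(1 - z) ^ (2 * N) = (- of_real ((chord t)\<^sup>2) * z) ^ N"
    by (simp only: power_mult)
  also have "\<dots> = (-1) ^ N * of_real (chord t ^ (2 * N)) * z ^ N"
    by (metis mult_minus1 of_real_power power_mult power_mult_distrib)
  finally have lhs: "(-1) ^ N * (1 - z) ^ (2 * N) * cis (- (real N * t)) = of_real (chord t ^ (2 * N))"
    by (simp add: z_def Complex.DeMoivre cis_mult flip: power_mult_distrib mult.assoc)
  have "(1 - z) ^ (2 * N) = (\<Sum>k\<le>2 * N. of_nat ((2 * N) choose k) * (- z) ^ k)"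
    using binomial_ring[of "- z" 1 "2 * N"] by simp
  hence "of_real (chord t ^ (2 * N)) =
      (\<Sum>k\<le>2 * N. (-1) ^ N * (of_nat ((2 * N) choose k) * (- z) ^ k) * cis (- (real N * t)))"
    unfolding lhs[symmetric] by (simp add: sum_distrib_left sum_distrib_right)
  also have "\<dots> = (\<Sum>k\<le>2 * N. of_real ((-1) ^ (k + N) * real ((2 * N) choose k))
                     * cis ((real k - real N) * t))"
  proof (rule sum.cong[OF refl])
    fix k
    have "(- z) ^ k * cis (- (real N * t)) = (-1) ^ k * cis ((real k - real N) * t)"
      unfolding power_minus[of z] by (simp add: z_def Complex.DeMoivre mult.assoc cis_mult left_diff_distrib)
    thus "(-1) ^ N * (of_nat ((2 * N) choose k) * (- z) ^ k) * cis (- (real N * t)) =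
        of_real ((-1) ^ (k + N) * real ((2 * N) choose k)) * cis ((real k - real N) * t)"
      by (simp add: power_add mult_ac)
  qed
  finally have "Re (of_real (chord t ^ (2 * N))) = Re (\<Sum>k\<le>2 * N. of_real ((-1) ^ (k + N) * real ((2 * N) choose k))
                     * cis ((real k - real N) * t))"
    by (rule arg_cong)
  thus ?thesis
    by (simp only: Re_complex_of_real Re_sum times_complex.sel Im_complex_of_real cis.sel mult_zero_left diff_zero)
qed

lemma sum_symmetric:
  fixes g :: "nat \<Rightarrow> real"
  assumes "\<And>k. k < N \<Longrightarrow> g (2 * N - k) = g k" "g N = 0"
  shows "(\<Sum>k\<le>2 * N. g k) = 2 * (\<Sum>k<N. g k)"
proof -
  have "{..2 * N} = {..<N} \<union> insert N {N<..2 * N}" by auto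
  hence "(\<Sum>k\<le>2 * N. g k) = (\<Sum>k<N. g k) + (\<Sum>k\<in>{N<..2 * N}. g k)"
    using assms(2) by (simp only:) (subst sum.union_disjoint, auto)
  also have "(\<Sum>k\<in>{N<..2 * N}. g k) = (\<Sum>k<N. g k)"
  proof (rule sum.reindex_bij_witness[of _ "\<lambda>k. 2 * N - k" "\<lambda>k. 2 * N - k"])
    fix k assume k: "k \<in> {N<..2 * N}"
    thus "g (2 * N - k) = g k"
      using assms(1)[of "2 * N - k"] by auto
  qed auto
  finally show ?thesis by simp
qed

text \<open>
  Both sides are half the derivative of \<open>chord t ^ (2 * N)\<close>.  On the left, that derivative runs
  over all \<open>k \<le> 2 * N\<close>, and its terms are symmetric about the vanishing one at \<open>k = N\<close>.
\<close>

lemma sin_sum_eq_chord_power: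
  assumes "N > 0"
  shows "(\<Sum>k<N. (-1) ^ (k + N + 1) * real ((2 * N) choose k) * (real N - real k) * sin ((real N - real k) * t))
         = real N * chord t ^ (2 * N - 1) * cos (t / 2)"
proof -
  define g where "g k = (-1) ^ (k + N + 1) * real ((2 * N) choose k) * (real N - real k)
                     * sin ((real N - real k) * t)" for k
  have "((\<lambda>t. chord t ^ (2 * N)) has_real_derivative
           2 * real N * chord t ^ (2 * N - 1) * cos (t / 2)) (at t)"
    using DERIV_chord_power[of "2 * N - 1" t] assms by simp
  moreover have "((\<lambda>t. chord t ^ (2 * N)) has_real_derivative (\<Sum>k\<le>2 * N. g k)) (at t)"
    unfolding chord_power_eq_cos_sum g_def
  proof (intro DERIV_sum)
    fix k
    have "sin ((real k - real N) * t) = - sin ((real N - real k) * t)"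
      by (metis minus_diff_eq mult_minus_left sin_minus)
    thus "((\<lambda>t. (-1) ^ (k + N) * real ((2 * N) choose k) * cos ((real k - real N) * t))
        has_real_derivative (-1) ^ (k + N + 1) * real ((2 * N) choose k) * (real N - real k)
                     * sin ((real N - real k) * t)) (at t)"
      by (auto intro!: derivative_eq_intros simp: algebra_simps)
  qed
  ultimately have "(\<Sum>k\<le>2 * N. g k) = 2 * real N * chord t ^ (2 * N - 1) * cos (t / 2)"
    by (rule DERIV_unique[rotated])
  moreover have "(\<Sum>k\<le>2 * N. g k) = 2 * (\<Sum>k<N. g k)"
  proof (rule sum_symmetric)
    fix k assume k: "k < N"
    have "(-1 :: real) ^ (2 * N - k + N + 1) = (-1) ^ (k + N + 1)"
      unfolding minus_one_power_iff using k by simp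
    moreover have "real N - real (2 * N - k) = - (real N - real k)"
      using k by simp
    moreover have "(2 * N) choose (2 * N - k) = (2 * N) choose k"
      using k by (subst binomial_symmetric) auto
    ultimately show "g (2 * N - k) = g k"
      unfolding g_def by (simp only: mult_minus_left sin_minus mult_minus_right minus_minus)
  qed (simp add: g_def)
  ultimately show ?thesis by (simp add: g_def)
qed

text \<open>
  The inner sum of the series with the \<open>\<pi>\<close> in the argument of \<open>Si\<close> made variable.
\<close>

definition si_sum :: "nat \<Rightarrow> real \<Rightarrow> real" where
  "si_sum n t = (\<Sum>k=0..n. ((-1) ^ (k + n) * Si (t * (real n + 1 - real k)) * real ((2 * n + 1) choose k)
        * (real n - real k + 1))
     / ((real n)\<^sup>2 * real ((2 * n) choose n) * (2 * real n - real k + 2)))"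

lemma isCont_si_sum: "isCont (si_sum n) t"
proof -
  have "isCont (\<lambda>t. Si (t * c)) t" for c
    by (rule isCont_o2[OF _ isCont_Si]) (intro continuous_intros)
  thus ?thesis
    unfolding si_sum_def [abs_def] divide_inverse
    by (intro continuous_sum isCont_mult continuous_const)
qed

lemma binomial_absorb_weight:
  assumes "k \<le> n"
  shows "real ((2 * n + 1) choose k) / (2 * real n - real k + 2) = real ((2 * n + 2) choose k) / (2 * real n + 2)"
proof -
  have "real (2 * n + 2 - k) * real ((2 * n + 2) choose k) = real (2 * n + 2) * real ((2 * n + 1) choose k)"
    using binomial_absorb_comp[of "2 * n + 2" k] by (simp only: flip: of_nat_mult) simp
  moreover have "real (2 * n + 2 - k) = 2 * real n - real k + 2" "2 * real n - real k + 2 > 0"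
    using assms by auto
  ultimately show ?thesis by (simp add: field_simps)
qed

text \<open>
  The trigonometric identity with \<open>N = n + 1\<close> collapses the sum of the derivatives to
  \<open>chord t ^ (2 * n + 1) * cos (t / 2)\<close>; one factor \<open>chord t\<close> is joined with the cosine to
  \<open>sin t\<close>.
\<close>

lemma DERIV_si_sum:
  assumes "t \<noteq> 0"
  shows "(si_sum n has_real_derivative
           chord t ^ (2 * n) / ((real n)\<^sup>2 * real ((2 * n) choose n)) * (sin t / t) / 2) (at t)"
proof -
  define c where "c = (real n)\<^sup>2 * real ((2 * n) choose n)"
  have "(si_sum n has_real_derivative (\<Sum>k=0..n. ((-1) ^ (k + n) *
         (sin ((real n + 1 - real k) * t) / t) * real ((2 * n + 1) choose k)
        * (real n - real k + 1)) / (c * (2 * real n - real k + 2)))) (at t)"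
    unfolding si_sum_def c_def
  proof (intro DERIV_sum DERIV_cdivide DERIV_cmult DERIV_cmult_right)
    fix k assume "k \<in> {0..n}"
    hence j: "real n + 1 - real k \<noteq> 0" by auto
    show "((\<lambda>t. Si (t * (real n + 1 - real k))) has_real_derivative
             sin ((real n + 1 - real k) * t) / t) (at t)"
      by (rule DERIV_cong, rule DERIV_chain2[OF DERIV_Si], rule DERIV_cmult_right, rule DERIV_ident)
         (use j assms in \<open>simp add: mult.commute\<close>)
  qed
  also have "(\<Sum>k=0..n. ((-1) ^ (k + n) *
         (sin ((real n + 1 - real k) * t) / t) * real ((2 * n + 1) choose k)
        * (real n - real k + 1)) / (c * (2 * real n - real k + 2))) =
      (\<Sum>k<n + 1. (-1) ^ (k + (n + 1) + 1) * real ((2 * (n + 1)) choose k) * (real (n + 1) - real k)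
          * sin ((real (n + 1) - real k) * t) * (1 / (c * t * (2 * real n + 2))))"
  proof (rule sum.cong)
    fix k assume "k \<in> {..<n + 1}"
    hence k: "real ((2 * n + 1) choose k) / (2 * real n - real k + 2) =
        real ((2 * (n + 1)) choose k) / (2 * real n + 2)"
      using binomial_absorb_weight[of k n] by simp
    have "((-1) ^ (k + n) * (sin ((real n + 1 - real k) * t) / t) * real ((2 * n + 1) choose k)
        * (real n - real k + 1)) / (c * (2 * real n - real k + 2)) =
       (-1) ^ (k + n) * sin ((real n + 1 - real k) * t) * (real n - real k + 1) / (c * t)
        * (real ((2 * n + 1) choose k) / (2 * real n - real k + 2))"
      by (simp only: times_divide_times_eq times_divide_eq_right times_divide_eq_left divide_divide_eq_left mult_ac)
    also have "\<dots> = (-1) ^ (k + (n + 1) + 1) * real ((2 * (n + 1)) choose k) * (real (n + 1) - real k)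
          * sin ((real (n + 1) - real k) * t) * (1 / (c * t * (2 * real n + 2)))"
      unfolding k by (simp add: mult_ac add_ac)
    finally show "((-1) ^ (k + n) * (sin ((real n + 1 - real k) * t) / t) * real ((2 * n + 1) choose k)
        * (real n - real k + 1)) / (c * (2 * real n - real k + 2)) = \<dots>" .
  qed auto
  also have "\<dots> = real (n + 1) * chord t ^ (2 * (n + 1) - 1) * cos (t / 2) * (1 / (c * t * (2 * real n + 2)))"
    unfolding sum_distrib_right[symmetric] by (subst sin_sum_eq_chord_power) simp_all
  also have "\<dots> = chord t ^ (2 * n) / c * (chord t * cos (t / 2) / t) / 2"
    by (simp add: divide_simps)
  also have "chord t * cos (t / 2) = sin t"
    using sin_double[of "t / 2"] by (simp add: chord_def)
  finally show ?thesis by (simp add: c_def)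
qed

section \<open>The power series of the squared arcsine\<close>

text \<open>
  For \<open>\<bar>t\<bar> \<le> \<pi>\<close>, \<open>t\<^sup>2 / 2\<close> is \<open>2 arcsin\<^sup>2 (sin (t/2))\<close>, so this is the remainder of the power
  series of \<open>2 arcsin\<^sup>2\<close> after \<open>m\<close> terms; \<open>arcsin_sq_rest'\<close> is its derivative.
\<close>

definition arcsin_sq_rest :: "nat \<Rightarrow> real \<Rightarrow> real" where
  "arcsin_sq_rest m t =
     t\<^sup>2 / 2 - (\<Sum>i<m. chord t ^ (2 * Suc i) / ((real (Suc i))\<^sup>2 * real ((2 * Suc i) choose Suc i)))"

definition arcsin_sq_rest' :: "nat \<Rightarrow> real \<Rightarrow> real" where
  "arcsin_sq_rest' m t =
     t - (\<Sum>i<m. 2 * chord t ^ (2 * i + 1) * cos (t / 2) / (real (Suc i) * real ((2 * Suc i) choose Suc i)))"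

lemma DERIV_arcsin_sq_rest [derivative_intros]:
  "(arcsin_sq_rest m has_real_derivative arcsin_sq_rest' m t) (at t)"
  unfolding arcsin_sq_rest_def [abs_def] arcsin_sq_rest'_def
proof (intro DERIV_diff DERIV_sum)
  show "((\<lambda>t. t\<^sup>2 / 2) has_real_derivative t) (at t)"
    by (auto intro!: derivative_eq_intros)
  fix i
  have "((\<lambda>t. chord t ^ (2 * Suc i)) has_real_derivative
          real (2 * Suc i) * chord t ^ (2 * i + 1) * cos (t / 2)) (at t)"
    using DERIV_chord_power[of "2 * i + 1" t] by simp
  from DERIV_cdivide[OF this, of "(real (Suc i))\<^sup>2 * real ((2 * Suc i) choose Suc i)"]
  show "((\<lambda>t. chord t ^ (2 * Suc i) / ((real (Suc i))\<^sup>2 * real ((2 * Suc i) choose Suc i)))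
     has_real_derivative 2 * chord t ^ (2 * i + 1) * cos (t / 2) /
       (real (Suc i) * real ((2 * Suc i) choose Suc i))) (at t)"
    by (rule DERIV_cong) (simp add: power2_eq_square del: of_nat_Suc binomial_Suc_Suc mult_Suc_right)
qed

text \<open>
  Telescoping: by the recursion of the central binomial coefficients, the second derivative of the
  term number \<open>m + 1\<close> of the series is the difference of the value claimed for \<open>m\<close> and the one
  claimed for \<open>m + 1\<close>.  This is where the particular coefficients \<open>1 / (n\<^sup>2 (2n choose n))\<close> matter.
\<close>

lemma DERIV_arcsin_sq_rest':
  "(arcsin_sq_rest' m has_real_derivative chord t ^ (2 * m) / real ((2 * m) choose m)) (at t)"
proof (induction m)
  case 0
  show ?case by (simp add: arcsin_sq_rest'_def)
next
  case (Suc m)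
  define c where "c = real (Suc m) * real ((2 * Suc m) choose Suc m)"
  have c: "c = 2 * (2 * real m + 1) * real ((2 * m) choose m)"
    unfolding c_def central_binomial_Suc_real by (simp add: divide_eq_eq)
  have B: "real ((2 * m) choose m) \<noteq> 0" by simp
  have "((\<lambda>t. chord t ^ (2 * m + 1) * cos (t / 2)) has_real_derivative
      (2 * real m + 1) * chord t ^ (2 * m) * (cos (t / 2))\<^sup>2 - chord t ^ (2 * m + 1) * sin (t / 2) / 2) (at t)"
  proof -
    have "((\<lambda>t. cos (t / 2)) has_real_derivative - sin (t / 2) / 2) (at t)"
      by (auto intro!: derivative_eq_intros)
    from DERIV_mult[OF DERIV_chord_power[of "2 * m" t] this]
    show ?thesis
      by (rule DERIV_cong[OF back_subst[of "\<lambda>f. DERIV f t :> _"]]) (simp_all add: power2_eq_square algebra_simps)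
  qed
  also have "(2 * real m + 1) * chord t ^ (2 * m) * (cos (t / 2))\<^sup>2 - chord t ^ (2 * m + 1) * sin (t / 2) / 2
     = (2 * real m + 1) * chord t ^ (2 * m) - (real m + 1) / 2 * chord t ^ (2 * Suc m)"
    unfolding cos_squared_eq by (simp add: chord_def field_simps power2_eq_square)
  finally have D: "((\<lambda>t. 2 * (chord t ^ (2 * m + 1) * cos (t / 2)) / c) has_real_derivative
     2 * ((2 * real m + 1) * chord t ^ (2 * m) - (real m + 1) / 2 * chord t ^ (2 * Suc m)) / c) (at t)"
    by (intro DERIV_cdivide DERIV_cmult)
  have "2 * ((2 * real m + 1) * chord t ^ (2 * m) - (real m + 1) / 2 * chord t ^ (2 * Suc m)) / c
     = chord t ^ (2 * m) * (2 * (2 * real m + 1) / c) - chord t ^ (2 * Suc m) * (real (Suc m) / c)"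
  proof -
    have "2 * (a * p - b / 2 * q) / c = p * (2 * a / c) - q * (b / c)" for a b p q :: real
      by (simp add: diff_divide_distrib right_diff_distrib mult_ac)
    thus ?thesis by (simp only: of_nat_Suc add.commute)
  qed
  also have "2 * (2 * real m + 1) / c = 1 / real ((2 * m) choose m)"
    unfolding c by simp
  also have "real (Suc m) / c = 1 / real ((2 * Suc m) choose Suc m)"
    unfolding c_def by simp
  finally have "((\<lambda>t. 2 * (chord t ^ (2 * m + 1) * cos (t / 2)) / c) has_real_derivative
     chord t ^ (2 * m) / real ((2 * m) choose m) - chord t ^ (2 * Suc m) / real ((2 * Suc m) choose Suc m)) (at t)"
    using D by simp
  from DERIV_diff[OF Suc.IH this]
  show ?case
    by (simp add: arcsin_sq_rest'_def [abs_def] c_def mult.assoc diff_diff_eq)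
qed

lemma arcsin_sq_rest_0 [simp]: "arcsin_sq_rest m 0 = 0" "arcsin_sq_rest' m 0 = 0"
  by (simp_all add: arcsin_sq_rest_def arcsin_sq_rest'_def chord_def)

lemma arcsin_sq_rest_nonneg:
  assumes "0 \<le> t"
  shows "0 \<le> arcsin_sq_rest' m t" "0 \<le> arcsin_sq_rest m t"
proof -
  have *: "0 \<le> arcsin_sq_rest' m u" if "0 \<le> u" for u
  proof -
    have "arcsin_sq_rest' m 0 \<le> arcsin_sq_rest' m u"
      using that by (rule DERIV_nonneg_imp_nondecreasing)
        (blast intro: DERIV_arcsin_sq_rest' divide_nonneg_nonneg zero_le_even_power' of_nat_0_le_iff)
    thus ?thesis by simp
  qed
  from *[OF assms] show "0 \<le> arcsin_sq_rest' m t" .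
  have "arcsin_sq_rest m 0 \<le> arcsin_sq_rest m t"
    using assms by (rule DERIV_nonneg_imp_nondecreasing) (blast intro: DERIV_arcsin_sq_rest *)
  thus "0 \<le> arcsin_sq_rest m t" by simp
qed

text \<open>
  With \<open>x = (\<pi> - t) / 4\<close> the claim reads \<open>x \<le> sin (2x)\<close> on \<open>[0, \<pi>/4]\<close>.  It follows from
  \<open>x \<le> tan x\<close> and \<open>sin (2x) = 2 cos\<^sup>2 x tan x\<close>, as \<open>2 cos\<^sup>2 x \<ge> 1\<close> there.  The constant \<open>4\<close> is
  not sharp, but any constant serves the convergence.
\<close>

lemma pi_minus_le_cos_half:
  assumes "0 \<le> t" "t \<le> pi"
  shows "pi - t \<le> 4 * cos (t / 2)"
proof -
  define x where "x = (pi - t) / 4"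
  have x: "0 \<le> x" "x < pi / 2"
    using assms by (simp_all add: x_def) (use pi_gt_zero in linarith)
  have half: "cos (t / 2) = sin (2 * x)" "sin (t / 2) = cos (2 * x)"
  proof -
    have "2 * x = pi / 2 - t / 2" by (simp add: x_def field_simps)
    thus "cos (t / 2) = sin (2 * x)" "sin (t / 2) = cos (2 * x)"
      by (simp_all add: sin_diff cos_diff)
  qed
  have "0 \<le> sin (t / 2)"
    using assms by (intro sin_ge_zero) auto
  hence "1 \<le> 2 * (cos x)\<^sup>2"
    unfolding half cos_double_cos by simp
  moreover have t: "0 \<le> tan x"
    using x by (metis tan_gt_zero tan_zero order_le_less)
  ultimately have "tan x * 1 \<le> tan x * (2 * (cos x)\<^sup>2)"
    by (intro mult_left_mono)
  also have "\<dots> = sin (2 * x)"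
    using cos_gt_zero_pi[of x] x by (simp add: tan_def sin_double power2_eq_square)
  finally have "tan x \<le> cos (t / 2)"
    unfolding half by simp
  moreover have "x \<le> tan x"
    using abs_tan_ge[of x] x t by simp
  ultimately show ?thesis
    by (simp add: x_def)
qed

text \<open>
  A direct bound of \<open>r''\<close> is useless near \<open>t = \<pi>\<close>, where it grows like \<open>sqrt m\<close>.  The auxiliary
  function \<open>r + (\<pi> - t) r'\<close> dominates \<open>r\<close>, and in its derivative \<open>(\<pi> - t) r''\<close> the peak of
  \<open>r''\<close> is damped by the factor \<open>\<pi> - t\<close>.  Bounding that factor by a multiple of \<open>cos (t/2)\<close> makes
  the derivative an exact one, that of a multiple of \<open>sin (t/2) ^ (2 * m + 1)\<close>.
\<close>

lemma arcsin_sq_rest_le: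
  assumes "0 \<le> t" "t \<le> pi"
  shows "arcsin_sq_rest m t \<le> 8 / sqrt (real m + 1)"
proof -
  define B where "B = real ((2 * m) choose m)"
  \<comment> \<open>\<open>K\<close> makes the derivative of \<open>K * sin (u/2) ^ (2m+1)\<close> equal to \<open>4 * cos (u/2) * r'' u\<close>.\<close>
  define K where "K = 8 * 4 ^ m / ((2 * real m + 1) * B)"
  have B: "B > 0" by (simp add: B_def)
  hence K: "K \<ge> 0" by (simp add: K_def)
  define d where "d u = K * sin (u / 2) ^ (2 * m + 1) - (arcsin_sq_rest m u + (pi - u) * arcsin_sq_rest' m u)" for u
  have "d 0 \<le> d t"
    using assms(1)
  proof (rule DERIV_nonneg_imp_nondecreasing)
    fix u assume u: "0 \<le> u" "u \<le> t"
    have "(d has_real_derivative K * ((2 * real m + 1) * sin (u / 2) ^ (2 * m) * (cos (u / 2) / 2))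
        - (pi - u) * (chord u ^ (2 * m) / B)) (at u)"
    proof -
      have "((\<lambda>u. sin (u / 2) ^ Suc (2 * m)) has_real_derivative
              (1 + real (2 * m)) * (cos (u / 2) / 2 * sin (u / 2) ^ (2 * m))) (at u)"
        by (intro DERIV_power_Suc) (auto intro!: derivative_eq_intros)
      hence main: "((\<lambda>u. K * sin (u / 2) ^ (2 * m + 1)) has_real_derivative
              K * ((2 * real m + 1) * sin (u / 2) ^ (2 * m) * (cos (u / 2) / 2))) (at u)"
        by (intro DERIV_cmult) (simp add: mult_ac add.commute)
      have "((\<lambda>u. arcsin_sq_rest m u + (pi - u) * arcsin_sq_rest' m u) has_real_derivative
              (pi - u) * (chord u ^ (2 * m) / B)) (at u)"
        unfolding B_def by (auto intro!: derivative_eq_intros DERIV_arcsin_sq_rest')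
      from DERIV_diff[OF main this] show ?thesis
        unfolding d_def [abs_def] .
    qed
    also have "K * ((2 * real m + 1) * sin (u / 2) ^ (2 * m) * (cos (u / 2) / 2))
        = 4 * cos (u / 2) * (chord u ^ (2 * m) / B)"
      using B by (simp add: K_def chord_def power_mult_distrib power_mult)
    also have "4 * cos (u / 2) * (chord u ^ (2 * m) / B) - (pi - u) * (chord u ^ (2 * m) / B)
        = (4 * cos (u / 2) - (pi - u)) * (chord u ^ (2 * m) / B)"
      by (simp only: left_diff_distrib)
    finally show "\<exists>y. (d has_real_derivative y) (at u) \<and> 0 \<le> y"
      using pi_minus_le_cos_half[of u] u assms B
      by (intro exI[of _ "(4 * cos (u / 2) - (pi - u)) * (chord u ^ (2 * m) / B)"])
         (auto intro!: mult_nonneg_nonneg)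
  qed
  hence "arcsin_sq_rest m t + (pi - t) * arcsin_sq_rest' m t \<le> K * sin (t / 2) ^ (2 * m + 1)"
    by (simp add: d_def)
  moreover have "(pi - t) * arcsin_sq_rest' m t \<ge> 0"
    using assms arcsin_sq_rest_nonneg(1)[of t m] by simp
  moreover have "sin (t / 2) ^ (2 * m + 1) \<le> 1"
    using assms by (intro power_le_one sin_ge_zero) auto
  with K have "K * sin (t / 2) ^ (2 * m + 1) \<le> K"
    by (metis mult_left_mono mult.right_neutral)
  moreover have "K \<le> 8 / sqrt (real m + 1)"
    using wallis_bound[of m] by (simp add: K_def B_def)
  ultimately show ?thesis by linarith
qed

section \<open>Summation of the series\<close>

text \<open>
  The difference \<open>\<Delta>\<close> between the limit primitive \<open>(sin t - t cos t) / 4\<close> and the partial sum has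
  derivative \<open>arcsin_sq_rest m t * (sin t / t) / 2\<close>, which lies between \<open>0\<close> and
  \<open>\<epsilon> = 4 / sqrt (m + 1)\<close> on the open interval, so \<open>\<Delta> \<pi>\<close> lies between \<open>0\<close> and \<open>\<epsilon> \<pi>\<close>.  At
  \<open>t = 0\<close>, where the quotient \<open>sin t / t\<close> degenerates, continuity of \<open>\<Delta>\<close> suffices.
\<close>

lemma si_sum_partial_bounds:
  "pi / 4 - (\<Sum>i<m. si_sum (Suc i) pi) \<in> {0..4 * pi / sqrt (real m + 1)}"
proof -
  define \<Delta> where "\<Delta> t = (sin t - t * cos t) / 4 - (\<Sum>i<m. si_sum (Suc i) t)" for t
  define \<epsilon> where "\<epsilon> = 4 / sqrt (real m + 1)"
  have D: "(\<Delta> has_real_derivative arcsin_sq_rest m t * (sin t / t) / 2) (at t)" if "t > 0" for t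
  proof -
    have "((\<lambda>t. (sin t - t * cos t) / 4) has_real_derivative (t\<^sup>2 / 2) * (sin t / t) / 2) (at t)"
      using that by (auto intro!: derivative_eq_intros simp: power2_eq_square field_simps)
    hence "(\<Delta> has_real_derivative (t\<^sup>2 / 2) * (sin t / t) / 2 -
        (\<Sum>i<m. chord t ^ (2 * Suc i) / ((real (Suc i))\<^sup>2 * real ((2 * Suc i) choose Suc i)) * (sin t / t) / 2)) (at t)"
      unfolding \<Delta>_def [abs_def] using that by (intro DERIV_diff DERIV_sum DERIV_si_sum) auto
    thus ?thesis
      unfolding arcsin_sq_rest_def left_diff_distrib diff_divide_distrib sum_distrib_right sum_divide_distrib .
  qed
  have sinc: "0 \<le> sin t / t" "sin t / t \<le> 1" if "0 < t" "t < pi" for t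
    using that sin_gt_zero[of t] sin_x_le_x[of t] by auto
  have cont: "continuous_on {0..pi} \<Delta>"
    unfolding \<Delta>_def [abs_def]
    by (intro continuous_intros continuous_at_imp_continuous_on[of _ "si_sum _"] ballI isCont_si_sum) simp
  have zero: "\<Delta> 0 = 0"
    by (simp add: \<Delta>_def si_sum_def Si_alt_def zero_ereal_def)
  have "\<Delta> 0 \<le> \<Delta> pi"
  proof (rule DERIV_nonneg_imp_increasing_open[OF _ _ cont])
    fix t :: real assume t: "0 < t" "t < pi"
    show "\<exists>y. (\<Delta> has_real_derivative y) (at t) \<and> 0 \<le> y"
      using D[OF t(1)] mult_nonneg_nonneg[OF arcsin_sq_rest_nonneg(2)[of t m] sinc(1)[OF t]] t
      by (intro exI[of _ "arcsin_sq_rest m t * (sin t / t) / 2"]) simp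
  qed simp
  moreover have "\<epsilon> * 0 - \<Delta> 0 \<le> \<epsilon> * pi - \<Delta> pi"
  proof (rule DERIV_nonneg_imp_increasing_open[where f = "\<lambda>t. \<epsilon> * t - \<Delta> t"])
    fix t :: real assume t: "0 < t" "t < pi"
    have "arcsin_sq_rest m t * (sin t / t) \<le> arcsin_sq_rest m t * 1"
      using sinc(2)[OF t] arcsin_sq_rest_nonneg(2)[of t m] t by (intro mult_left_mono) auto
    also have "\<dots> \<le> 2 * \<epsilon>"
      using arcsin_sq_rest_le[of t m] t by (simp add: \<epsilon>_def)
    finally have "0 \<le> \<epsilon> - arcsin_sq_rest m t * (sin t / t) / 2" by simp
    moreover have "((\<lambda>t. \<epsilon> * t - \<Delta> t) has_real_derivative
        \<epsilon> - arcsin_sq_rest m t * (sin t / t) / 2) (at t)"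
      using D[OF t(1)] by (auto intro!: derivative_eq_intros)
    ultimately show "\<exists>y. ((\<lambda>t. \<epsilon> * t - \<Delta> t) has_real_derivative y) (at t) \<and> 0 \<le> y"
      by blast
  qed (auto intro!: continuous_intros cont)
  ultimately show ?thesis
    unfolding zero by (simp add: \<Delta>_def \<epsilon>_def mult.commute)
qed

theorem theorem3:
  shows "(\<lambda>m. let n = m + 1 in \<Sum>k=0..n. si_summand n k) sums (pi / 4)"
proof -
  have eq: "(\<lambda>m. let n = m + 1 in \<Sum>k=0..n. si_summand n k) = (\<lambda>m. si_sum (Suc m) pi)"
    by (simp add: si_sum_def si_summand_def Let_def)
  have "(\<lambda>m. 4 * pi / sqrt (real m + 1)) \<longlonglongrightarrow> 0"
    by real_asymp
  hence "(\<lambda>m. pi / 4 - (\<Sum>i<m. si_sum (Suc i) pi)) \<longlonglongrightarrow> 0"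
    by (rule tendsto_sandwich[OF _ _ tendsto_const, rotated -1])
       (use si_sum_partial_bounds in auto)
  hence "(\<lambda>m. \<Sum>i<m. si_sum (Suc i) pi) \<longlonglongrightarrow> pi / 4"
    by (simp add: LIMSEQ_iff abs_minus_commute)
  thus ?thesis unfolding eq sums_def .
qed

end
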